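(* For all integers $m\geq 2$ and $k\geq1$, $$\zeta_{\mathcal P}(\{m\}^k)=\sum_{\substack{\lambda=(a_1,\ldots,a_j)\in\mathcal C\\ |\lambda|=k}}\zeta(a_1m,a_2m,\ldots,a_jm).$$
   Context: For a partition $\lambda$, $\ell(\lambda)$ is its number of parts and $n_\lambda$ the product of its parts; $\zeta_{\mathcal P}(\{m\}^k):=\sum_{\ell(\lambda)=k}n_\lambda^{-m}$, the sum over all integer partitions of length $k$, i.e. $\sum_{n_1\geq n_2\geq\dots\geq n_k\geq1}(n_1\cdots n_k)^{-m}$. A composition is a finite tuple $\lambda=(a_1,\dots,a_j)$ of positive integers, of size $|\lambda|:=a_1+\dots+a_j$; $\mathcal C$ is the set of all compositions. For positive integers $m_1,\dots,m_j$ with $m_1\geq2$, the multiple zeta value is $\zeta(m_1,\dots,m_j):=\sum_{n_1>n_2>\dots>n_j\geq1}\frac{1}{n_1^{m_1}\cdots n_j^{m_j}}$. *)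

theory Defs
  imports "HOL-Analysis.Analysis"
begin

text \<open>
  Integer partitions are represented by their weakly decreasing lists of parts, so that each
  partition corresponds to exactly one list. Its length \<open>\<ell>(\<lambda>)\<close> is \<^const>\<open>length\<close>, and the product
  \<open>n\<^sub>\<lambda>\<close> of its parts is \<^const>\<open>prod_list\<close>.
\<close>

definition integer_partition :: "nat list \<Rightarrow> bool" where
  "integer_partition l \<longleftrightarrow> sorted_wrt (\<ge>) l \<and> (\<forall>n\<in>set l. 1 \<le> n)"

text \<open>
  The value \<open>\<zeta>\<^sub>P({m}\<^sup>k)\<close>. The summands are nonnegative, so unconditional summation agrees with any
  order of summation; the series converges for \<open>m \<ge> 2\<close>.
\<close>

definition partition_zeta :: "nat \<Rightarrow> nat \<Rightarrow> real" where
  "partition_zeta m k =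
     (\<Sum>\<^sub>\<infinity>l\<in>{l. integer_partition l \<and> length l = k}. 1 / real (prod_list l) ^ m)"

definition compositions :: "nat list set" where
  "compositions = {as. \<forall>a\<in>set as. 1 \<le> a}"

text \<open>
  The multiple zeta value \<open>\<zeta>(m\<^sub>1, \<dots>, m\<^sub>j)\<close> of the list \<open>ms = [m\<^sub>1, \<dots>, m\<^sub>j]\<close>, meaningful when all
  entries are positive and \<open>m\<^sub>1 \<ge> 2\<close>, which ensures convergence. The largest summation variable
  comes first.
\<close>

definition multiple_zeta :: "nat list \<Rightarrow> real" where
  "multiple_zeta ms =
     (\<Sum>\<^sub>\<infinity>ns\<in>{ns. length ns = length ms \<and> sorted_wrt (>) ns \<and> (\<forall>n\<in>set ns. 1 \<le> n)}.
        1 / (\<Prod>i<length ms. real (ns ! i) ^ (ms ! i)))"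

lemma finite_compositions_of_size: "finite {as \<in> compositions. sum_list as = k}"
proof (rule finite_subset)
  have "length as \<le> sum_list as" if "\<forall>a\<in>set as. 1 \<le> a" for as :: "nat list"
    using that by (induction as) auto
  then show "{as \<in> compositions. sum_list as = k} \<subseteq> {as. set as \<subseteq> {..k} \<and> length as \<le> k}"
    by (auto simp: compositions_def dest: member_le_sum_list)
  show "finite {as. set as \<subseteq> {..k} \<and> length as \<le> k}"
    by (rule finite_lists_length_le) simp
qed

end

theory Submission
  imports Defs
begin

text \<open>
  A weakly decreasing list splits uniquely into maximal constant runs. Recording the run lengths
  \<open>a\<^sub>1, \<dots>, a\<^sub>j\<close> and the run values \<open>n\<^sub>1 > \<dots> > n\<^sub>j\<close> identifies the partitions of length \<open>k\<close> with the
  pairs consisting of a composition of \<open>k\<close> into \<open>j\<close> parts and a strictly decreasing list of \<open>j\<close>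
  positive integers (\<open>bij_betw_expand_runs\<close>). Under this identification the product of the parts
  becomes \<open>n\<^sub>1 ^ a\<^sub>1 \<cdots> n\<^sub>j ^ a\<^sub>j\<close>, so that summing first over the run values and then over the finitely
  many compositions gives the sum of multiple zeta values. For \<open>m \<ge> 2\<close> the series over all lists of
  \<open>k\<close> positive integers converges, being the \<open>k\<close>-th power of \<open>\<Sum>n. 1 / n ^ m\<close>
  (\<open>summable_on_prod_list\<close>); this justifies the rearrangement.
\<close>

text \<open>
  The list with run lengths \<open>as\<close> and run values \<open>ns\<close>, that is, \<open>ns ! 0\<close> repeated \<open>as ! 0\<close> times,
  followed by \<open>ns ! 1\<close> repeated \<open>as ! 1\<close> times, and so on. Adjacent runs are separated only when
  adjacent values differ, and only the case of two lists of equal length is of interest.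
\<close>

definition expand_runs :: "nat list \<Rightarrow> 'a list \<Rightarrow> 'a list" where
  "expand_runs as ns = concat (map2 replicate as ns)"

lemma expand_runs_Nil [simp]: "expand_runs [] [] = []"
  by (simp add: expand_runs_def)

lemma expand_runs_Cons [simp]:
  "expand_runs (a # as) (n # ns) = replicate a n @ expand_runs as ns"
  by (simp add: expand_runs_def)

lemma length_expand_runs:
  "length as = length ns \<Longrightarrow> length (expand_runs as ns) = sum_list as"
  by (induction as ns rule: list_induct2) auto

lemma set_expand_runs_subset: "set (expand_runs as ns) \<subseteq> set ns"
  unfolding expand_runs_def by (auto dest: set_zip_rightD split: if_splits)

lemma sorted_wrt_ge_replicate: "sorted_wrt (\<ge>) (replicate a (n :: 'a :: order))"
  by (induction a) auto

lemma sorted_wrt_expand_runs: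
  fixes ns :: "'a :: order list"
  assumes "length as = length ns" and "sorted_wrt (>) ns"
  shows "sorted_wrt (\<ge>) (expand_runs as ns)"
  using assms
proof (induction as ns rule: list_induct2)
  case (Cons a as n ns)
  then show ?case
    using set_expand_runs_subset[of as ns]
    by (auto simp: sorted_wrt_append sorted_wrt_ge_replicate intro: less_imp_le)
qed simp

lemma prod_list_expand_runs:
  fixes ns :: "'a :: comm_semiring_1 list"
  assumes "length as = length ns"
  shows "prod_list (expand_runs as ns) = (\<Prod>i<length as. (ns ! i) ^ (as ! i))"
  using assms
proof (induction as ns rule: list_induct2)
  case (Cons a as n ns)
  then show ?case
    by (simp add: prod.lessThan_Suc_shift del: prod.lessThan_Suc)
qed simp

lemma expand_runs_inject:
  fixes ns ns' :: "'a :: order list"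
  assumes "length as = length ns" and "length as' = length ns'"
    and "sorted_wrt (>) ns" and "sorted_wrt (>) ns'"
    and "\<forall>a\<in>set as. 1 \<le> a" and "\<forall>a\<in>set as'. 1 \<le> a"
    and "expand_runs as ns = expand_runs as' ns'"
  shows "as = as' \<and> ns = ns'"
  using assms
proof (induction as ns arbitrary: as' ns' rule: list_induct2)
  case Nil
  then show ?case
    by (cases as'; cases ns') auto
next
  case (Cons a as n ns)
  from Cons.prems obtain a' bs n' ms where eq: "as' = a' # bs" "ns' = n' # ms"
    by (cases as'; cases ns') auto
  have pos: "a > 0" "a' > 0"
    using Cons.prems eq by auto
  have runs: "replicate a n @ expand_runs as ns = replicate a' n' @ expand_runs bs ms"
    using Cons.prems eq by simp
  then have n: "n = n'"
    using pos by (cases a; cases a') auto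
  \<comment> \<open>All later values are smaller, so the first run length counts the occurrences of \<open>n\<close>.\<close>
  have "n \<notin> set (expand_runs as ns)" "n \<notin> set (expand_runs bs ms)"
    using Cons.prems eq n set_expand_runs_subset[of as ns] set_expand_runs_subset[of bs ms]
    by auto
  then have "length (filter ((=) n) (expand_runs as ns)) = 0"
    "length (filter ((=) n) (expand_runs bs ms)) = 0"
    by (auto simp: filter_empty_conv)
  then have a: "a = a'"
    using arg_cong[OF runs, of "\<lambda>l. length (filter ((=) n) l)"] n by simp
  show ?case
    using Cons.IH[of bs ms] Cons.prems eq runs n a by auto
qed

text \<open>
  Run-length encoding of a weakly decreasing list. The equation \<open>set ns = set l\<close> carries positivity
  over from the list to its run values, and in the induction it decides whether a new first entry
  extends the first run or starts a run of its own.
\<close>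

lemma expand_runs_surj:
  fixes l :: "'a :: order list"
  assumes "sorted_wrt (\<ge>) l"
  shows "\<exists>as ns. length as = length ns \<and> sorted_wrt (>) ns \<and> (\<forall>a\<in>set as. 1 \<le> a) \<and>
    set ns = set l \<and> expand_runs as ns = l"
  using assms
proof (induction l)
  case Nil
  show ?case
    by (intro exI[of _ "[]"]) simp
next
  case (Cons x l)
  then obtain as ns where IH: "length as = length ns" "sorted_wrt (>) ns" "\<forall>a\<in>set as. 1 \<le> a"
    "set ns = set l" "expand_runs as ns = l"
    by auto
  show ?case
  proof (cases "x \<in> set ns")
    case True
    then obtain n ms where ns: "ns = n # ms"
      by (cases ns) auto
    then obtain a bs where as: "as = a # bs"
      using IH by (cases as) auto
    \<comment> \<open>The new entry bounds the list, hence a repeated value is the value of the first run.\<close>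
    have "n \<le> x"
      using Cons.prems IH ns by auto
    then have "x = n"
      using True IH ns by auto
    then show ?thesis
      using IH ns as by (intro exI[of _ "Suc a # bs"] exI[of _ ns]) auto
  next
    case False
    then have "\<forall>n\<in>set ns. n < x"
      using Cons.prems IH by (auto simp: less_le)
    then show ?thesis
      using IH by (intro exI[of _ "1 # as"] exI[of _ "x # ns"]) auto
  qed
qed

lemma bij_betw_expand_runs:
  "bij_betw (\<lambda>(as, ns). expand_runs as ns)
     (SIGMA as:{as \<in> compositions. sum_list as = k}.
        {ns. length ns = length as \<and> sorted_wrt (>) ns \<and> (\<forall>n\<in>set ns. 1 \<le> n)})
     {l. integer_partition l \<and> length l = k}"
  (is "bij_betw ?f ?S ?P")
  unfolding bij_betw_def
proof
  show "inj_on ?f ?S"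
    by (rule inj_onI) (auto simp: compositions_def dest!: expand_runs_inject[rotated -1])
  show "?f ` ?S = ?P"
  proof
    show "?f ` ?S \<subseteq> ?P"
      using set_expand_runs_subset
      by (fastforce simp: integer_partition_def sorted_wrt_expand_runs length_expand_runs)
    show "?P \<subseteq> ?f ` ?S"
    proof
      fix l assume "l \<in> ?P"
      then have l: "sorted_wrt (\<ge>) l" "\<forall>n\<in>set l. 1 \<le> n" "length l = k"
        by (auto simp: integer_partition_def)
      from expand_runs_surj[OF l(1)] obtain as ns where
        runs: "length as = length ns" "sorted_wrt (>) ns" "\<forall>a\<in>set as. 1 \<le> a" "set ns = set l"
          "expand_runs as ns = l"
        by blast
      then have "(as, ns) \<in> ?S"
        using l length_expand_runs[of as ns] by (simp add: compositions_def)
      then show "l \<in> ?f ` ?S"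
        using runs(5) by force
    qed
  qed
qed

lemma summable_on_prod_list:
  fixes g :: "'a \<Rightarrow> real"
  assumes "g summable_on A" and "\<And>x. x \<in> A \<Longrightarrow> 0 \<le> g x"
  shows "(\<lambda>l. prod_list (map g l)) summable_on {l. set l \<subseteq> A \<and> length l = k}"
proof (induction k)
  case 0
  have "{l. set l \<subseteq> A \<and> length l = 0} = {[]}"
    by auto
  then show ?case
    by simp
next
  case (Suc k)
  let ?L = "{l. set l \<subseteq> A \<and> length l = k}"
  have nonneg: "0 \<le> prod_list (map g l)" if "l \<in> ?L" for l
    using that by (auto intro!: prod_list_nonneg assms(2))
  have "(\<lambda>(x, l). g x * prod_list (map g l)) summable_on A \<times> ?L"
  proof (rule summable_on_SigmaI)
    show "((\<lambda>l. case (x, l) of (x, l) \<Rightarrow> g x * prod_list (map g l)) has_sum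
        g x * (\<Sum>\<^sub>\<infinity>l\<in>?L. prod_list (map g l))) ?L" for x
      using Suc.IH by (simp add: has_sum_cmult_right)
    show "(\<lambda>x. g x * (\<Sum>\<^sub>\<infinity>l\<in>?L. prod_list (map g l))) summable_on A"
      using assms(1) by (rule summable_on_cmult_left)
  qed (use assms(2) nonneg in auto)
  moreover have "bij_betw (\<lambda>(x, l). x # l) (A \<times> ?L) {l. set l \<subseteq> A \<and> length l = Suc k}"
    unfolding bij_betw_def
  proof
    show "(\<lambda>(x, l). x # l) ` (A \<times> ?L) = {l. set l \<subseteq> A \<and> length l = Suc k}"
      by (force simp: length_Suc_conv)
  qed (auto simp: inj_on_def)
  ultimately show ?case
    by (subst summable_on_reindex_bij_betw[symmetric])
      (auto simp: case_prod_unfold)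
qed

lemma summable_on_integer_partition:
  assumes "m \<ge> 2"
  shows "(\<lambda>l. 1 / real (prod_list l) ^ m) summable_on {l. integer_partition l \<and> length l = k}"
proof -
  \<comment> \<open>The term at \<open>n = 0\<close> is \<open>0\<close> since \<open>1 / 0 = 0\<close>, so lists containing \<open>0\<close> may be admitted.\<close>
  have "summable (\<lambda>n. 1 / real n ^ m)"
    using inverse_power_summable[OF assms, where 'a = real] by (simp add: field_simps)
  then have "(\<lambda>n. 1 / real n ^ m) summable_on UNIV"
    by (rule summable_nonneg_imp_summable_on) simp
  then have "(\<lambda>l. prod_list (map (\<lambda>n. 1 / real n ^ m) l)) summable_on
      {l. set l \<subseteq> UNIV \<and> length l = k}"
    by (rule summable_on_prod_list) simp
  moreover have "prod_list (map (\<lambda>n. 1 / real n ^ m) l) = 1 / real (prod_list l) ^ m" for l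
    by (induction l) (auto simp: power_mult_distrib)
  ultimately have "(\<lambda>l. 1 / real (prod_list l) ^ m) summable_on {l. length l = k}"
    by simp
  then show ?thesis
    by (rule summable_on_subset_banach) auto
qed

theorem proposition2:
  fixes m k :: nat
  assumes "m \<ge> 2" and "k \<ge> 1"
  shows "partition_zeta m k =
    (\<Sum>as\<in>{as \<in> compositions. sum_list as = k}. multiple_zeta (map (\<lambda>a. a * m) as))"
proof -
  let ?C = "{as \<in> compositions. sum_list as = k}"
  let ?N = "\<lambda>as :: nat list.
    {ns :: nat list. length ns = length as \<and> sorted_wrt (>) ns \<and> (\<forall>n\<in>set ns. 1 \<le> n)}"
  let ?f = "\<lambda>l. 1 / real (prod_list l) ^ m"
  let ?g = "\<lambda>(as, ns). ?f (expand_runs as ns)"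
  have "?g summable_on Sigma ?C ?N"
    using summable_on_integer_partition[OF assms(1), of k]
      summable_on_reindex_bij_betw[OF bij_betw_expand_runs, of ?f k]
    by (simp add: case_prod_unfold)
  then have "infsum ?g (Sigma ?C ?N) = (\<Sum>\<^sub>\<infinity>as\<in>?C. \<Sum>\<^sub>\<infinity>ns\<in>?N as. ?f (expand_runs as ns))"
    by (subst infsum_Sigma'_banach) simp_all
  moreover have "(\<Sum>\<^sub>\<infinity>ns\<in>?N as. ?f (expand_runs as ns)) = multiple_zeta (map (\<lambda>a. a * m) as)" for as
    unfolding multiple_zeta_def
    by (rule infsum_cong_neutral)
      (auto simp: prod_list_expand_runs power_mult simp flip: prod_power_distrib)
  moreover have "partition_zeta m k = infsum ?g (Sigma ?C ?N)"
    unfolding partition_zeta_def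
    using infsum_reindex_bij_betw[OF bij_betw_expand_runs, of ?f k]
    by (simp add: case_prod_unfold)
  ultimately show ?thesis
    by (simp add: finite_compositions_of_size)
qed

end
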